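(* Let $\mathcal{G}$ be a directed graph with $n$ vertices, $m$ edges and incidence matrix $B\in\mathbb{R}^{n\times m}$. Let $H:\mathbb{R}^n\to\mathbb{R}$ be a strictly convex, twice differentiable function with positive definite Hessian at every point, having its minimum at the origin, and let $H_c:\mathbb{R}^m\to\mathbb{R}$, $H_c(x_c)=\frac12\|x_c\|^2$. Let $E$ be an $n\times k$ matrix each of whose columns has exactly one entry equal to $1$ or $-1$ and all other entries zero, and let $\bar d\in\mathbb{R}^k$ be a constant disturbance satisfying the matching condition: there exists $\bar x_c\in\mathbb{R}^m$ with $E\bar d = B\frac{\partial H_c}{\partial x_c}(\bar x_c)$. Let $x^*\in\mathbb{R}^n$ be a desired state and consider the system $$\begin{bmatrix} \dot{x} \\ \dot{x}_c \end{bmatrix} = \begin{bmatrix} -BB^T & -B \\ B^T & 0 \end{bmatrix} \begin{bmatrix} \frac{\partial H}{\partial x}(x-x^* ) \\ \frac{\partial H_c}{\partial x_c}(x_c) \end{bmatrix} + \begin{bmatrix} E \\ 0 \end{bmatrix} \bar d ,$$ with initial conditions $(x(0),x_c(0))\in\mathbb{R}^n\times\mathbb{R}^m$ such that $x^*$ belongs to the admissible set $\mathcal{A}=\{x\in\mathbb{R}^n \mid \mathds{1}^Tx=\mathds{1}^Tx(0)\}$. Then the trajectories of this system converge, as $t\to\infty$, to $$\mathcal{E}_{tot}=\Big\{(x^*, x_c) \;\Big|\; x_c\in\mathbb{R}^m,\ B\frac{\partial H_c}{\partial x_c}(x_c)=E\bar{d} \Big\}$$ if and only if $\mathcal{G}$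 is weakly connected.
   Context: A directed graph $\mathcal{G}$ consists of a finite vertex set, a finite edge set, and a map from edges to ordered pairs $(v,w)$ of distinct vertices (tail $v$, head $w$); self-loops are not allowed. Its incidence matrix $B$ is the $n\times m$ matrix whose $(i,j)$ entry is $1$ if edge $j$ points towards vertex $i$, $-1$ if edge $j$ originates from vertex $i$, and $0$ otherwise. $\mathcal{G}$ is weakly connected if the undirected graph obtained by ignoring orientations is connected. $\mathds{1}$ is the vector with all entries $1$. $\frac{\partial H}{\partial x}(x-x^* )$ denotes the gradient (column vector) of $H$ evaluated at $x-x^*$. "The trajectories converge to $\mathcal{E}_{tot}$" means that for every trajectory with initial condition satisfying $\mathds{1}^Tx(0)=\mathds{1}^Tx^*$, the distance from $(x(t),x_c(t))$ to $\mathcal{E}_{tot}$ tends to $0$ as $t\to\infty$. *)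

theory Defs
  imports "HOL-Analysis.Analysis" "Graph_Theory.Digraph_Component"
begin

section \<open>Incidence matrix and edge space\<close>

text \<open>
  Digraphs are those of \<^theory>\<open>Graph_Theory.Digraph\<close>: arcs are elements of their own type and
  may be parallel. The vertices will be all of the finite type \<open>'v\<close>. The arcs
  are an arbitrary subset of the finite type \<open>'e\<close>, because \<open>arcs G = UNIV\<close> would exclude the graph
  without edges. Accordingly the space of edge vectors (dimension \<open>card (arcs G)\<close>) is
  the coordinate subspace \<open>edge_space G\<close>, and columns of the incidence matrix that do not belong
  to an arc are zero. If \<open>arcs G = UNIV\<close>, the edge space is all of \<open>real^'e\<close>.
\<close>

definition edge_space :: "('v, 'e::finite) pre_digraph \<Rightarrow> (real^'e) set" where
  "edge_space G = {y. \<forall>e. e \<notin> arcs G \<longrightarrow> y $ e = 0}"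

definition incidence_matrix :: "('v::finite, 'e::finite) pre_digraph \<Rightarrow> real^'e^'v" where
  "incidence_matrix G = (\<chi> i e.
     if e \<in> arcs G \<and> head G e = i then 1
     else if e \<in> arcs G \<and> tail G e = i then -1
     else 0)"

section \<open>Gradient, Hessian and convexity\<close>

definition gradient :: "('a::real_inner \<Rightarrow> real) \<Rightarrow> 'a \<Rightarrow> 'a" where
  "gradient f x = (THE g. GDERIV f x :> g)"

definition twice_differentiable :: "('a::real_inner \<Rightarrow> real) \<Rightarrow> bool" where
  "twice_differentiable f \<longleftrightarrow> f differentiable_on UNIV \<and> gradient f differentiable_on UNIV"

definition hessian :: "(real^'n \<Rightarrow> real) \<Rightarrow> real^'n \<Rightarrow> real^'n^'n" where
  "hessian f x = matrix (frechet_derivative (gradient f) (at x))"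

text \<open>Symmetry is not required: the Hessian of a twice (totally) differentiable function has it.\<close>

definition positive_definite :: "real^'n^'n \<Rightarrow> bool" where
  "positive_definite A \<longleftrightarrow> (\<forall>v. v \<noteq> 0 \<longrightarrow> v \<bullet> (A *v v) > 0)"

definition strictly_convex :: "('a::real_vector \<Rightarrow> real) \<Rightarrow> bool" where
  "strictly_convex f \<longleftrightarrow>
     (\<forall>x y. \<forall>u. x \<noteq> y \<longrightarrow> 0 < u \<longrightarrow> u < 1 \<longrightarrow>
        f ((1 - u) *\<^sub>R x + u *\<^sub>R y) < (1 - u) * f x + u * f y)"

section \<open>The closed-loop system\<close>

definition signed_unit_columns :: "real^'k^'v \<Rightarrow> bool" where
  "signed_unit_columns E \<longleftrightarrow>
     (\<forall>j. \<exists>i. (E $ i $ j = 1 \<or> E $ i $ j = -1) \<and> (\<forall>i'. i' \<noteq> i \<longrightarrow> E $ i' $ j = 0))"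

definition H_c :: "real^'e \<Rightarrow> real" where
  "H_c y = 1 / 2 * (norm y)\<^sup>2"

definition matching_condition ::
  "('v::finite, 'e::finite) pre_digraph \<Rightarrow> real^'k^'v \<Rightarrow> real^'k \<Rightarrow> bool" where
  "matching_condition G E d \<longleftrightarrow>
     (\<exists>y \<in> edge_space G. E *v d = incidence_matrix G *v gradient H_c y)"

definition closed_loop ::
  "('v::finite, 'e::finite) pre_digraph \<Rightarrow> (real^'v \<Rightarrow> real) \<Rightarrow> real^'k^'v \<Rightarrow> real^'k \<Rightarrow> real^'v \<Rightarrow>
   (real^'v) \<times> (real^'e) \<Rightarrow> (real^'v) \<times> (real^'e)" where
  "closed_loop G H E d xs = (\<lambda>(x, y).
     let B = incidence_matrix G in
     ((- (B ** transpose B)) *v gradient H (x - xs) + (- B) *v gradient H_c y + E *v d,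
      transpose B *v gradient H (x - xs)))"

definition trajectory ::
  "('v::finite, 'e::finite) pre_digraph \<Rightarrow> (real^'v \<Rightarrow> real) \<Rightarrow> real^'k^'v \<Rightarrow> real^'k \<Rightarrow> real^'v \<Rightarrow>
   (real \<Rightarrow> (real^'v) \<times> (real^'e)) \<Rightarrow> bool" where
  "trajectory G H E d xs z \<longleftrightarrow>
     (\<forall>t\<ge>0. snd (z t) \<in> edge_space G \<and>
        (z has_vector_derivative closed_loop G H E d xs (z t)) (at t within {0..}))"

definition admissible :: "real^'v \<Rightarrow> (real^'v) set" where
  "admissible x0 = {x. (\<Sum>i\<in>UNIV. x $ i) = (\<Sum>i\<in>UNIV. x0 $ i)}"

definition E_tot ::
  "('v::finite, 'e::finite) pre_digraph \<Rightarrow> real^'k^'v \<Rightarrow> real^'k \<Rightarrow> real^'v \<Rightarrow>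
   ((real^'v) \<times> (real^'e)) set" where
  "E_tot G E d xs =
     {(xs, y) | y. y \<in> edge_space G \<and> incidence_matrix G *v gradient H_c y = E *v d}"

end

theory Submission
  imports Defs
begin

text \<open>
Let \<open>p\<close> be the deviation of the vertex state from \<open>xs\<close> and \<open>q\<close> that of the controller state from the
point that the matching condition provides. The disturbance then cancels, and with \<open>B\<close> the incidence matrix and
\<open>g\<close> the gradient of \<open>H\<close> the system reads \<open>p' = - B B\<^sup>T g(p) - B q\<close>, \<open>q' = B\<^sup>T g(p)\<close>. The energy
\<open>H(p) + |q|\<^sup>2 / 2\<close> decreases at the rate \<open>|B\<^sup>T g(p)|\<^sup>2\<close>. Strictly convex functions with a minimum have
bounded sublevel sets, so trajectories are bounded, and a Barbalat argument gives
\<open>B\<^sup>T g(p) \<longlonglongrightarrow> 0\<close> (\<open>dissipation_rate_tendsto_0\<close>).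

The standard conclusion is LaSalle's principle. Its usual form is for locally Lipschitz vector fields, and
a differentiable gradient need not be locally Lipschitz. A direct argument works for each single
trajectory: near a limit point \<open>(a, b)\<close> the controller state is almost at rest, so after one unit
of time \<open>p\<close> is near \<open>a - B b\<close>. Then \<open>B\<^sup>T g\<close> vanishes at \<open>a\<close> and at \<open>a - B b\<close>, and strict
monotonicity of \<open>g\<close> implies \<open>B b = 0\<close> (\<open>limit_point_stationary\<close>).

It remains to see when \<open>B\<^sup>T g(a) = 0\<close> forces \<open>a = 0\<close>. The kernel of \<open>B\<^sup>T\<close> consists of the
vectors that are constant on weakly connected components. If the graph is connected, \<open>g(a)\<close> is a multiple of
the all-ones vector, to which \<open>a\<close> is orthogonal since the sum of the state is conserved; this forces \<open>a = 0\<close>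
by strict monotonicity. If it is not, minimizing \<open>H\<close> with a prescribed nonzero
distribution of mass among the components, of total zero, gives an equilibrium outside the target set.
\<close>

section \<open>The kernel of the transposed incidence matrix\<close>

lemma inner_transpose_matrix_vector:
  fixes A :: "real^'n^'m"
  shows "(transpose A *v f) \<bullet> y = f \<bullet> (A *v y)"
  by (simp add: dot_lmul_matrix)

lemma incidence_matrix_transpose_nth:
  fixes G :: "('v::finite, 'e::finite) pre_digraph"
  assumes "loopfree_digraph G"
  shows "(transpose (incidence_matrix G) *v f) $ e
    = (if e \<in> arcs G then f $ head G e - f $ tail G e else 0)"
proof -
  have "e \<in> arcs G \<Longrightarrow> tail G e \<noteq> head G e"
    using assms by (rule loopfree_digraph.no_loops)
  then have "(\<Sum>i\<in>UNIV. incidence_matrix G $ i $ e * f $ i)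
    = (\<Sum>i\<in>UNIV. (if i = head G e then (if e \<in> arcs G then f $ i else 0) else 0)
        - (if i = tail G e then (if e \<in> arcs G then f $ i else 0) else 0))"
    by (intro sum.cong) (auto simp: incidence_matrix_def)
  also have "\<dots> = (if e \<in> arcs G then f $ head G e - f $ tail G e else 0)"
    by (simp add: sum_subtractf)
  finally show ?thesis
    by (simp add: matrix_vector_mult_def transpose_def)
qed

text \<open>
A vector is in the kernel of the transposed incidence matrix iff it takes equal values at both ends of
every arc, hence iff it is constant on the weakly connected components.
\<close>
lemma connected_iff_incidence_kernel_constant:
  fixes G :: "('v::finite, 'e::finite) pre_digraph"
  assumes "loopfree_digraph G" and "verts G = UNIV"
  shows "Digraph_Component.connected G \<longleftrightarrow>
    (\<forall>f. transpose (incidence_matrix G) *v f = 0 \<longrightarrow> (\<forall>u w. f $ u = f $ w))"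
proof -
  interpret loopfree_digraph G by fact
  interpret S: pair_wf_digraph "mk_symmetric G" by (rule wellformed_mk_symmetric)
  have ker: "transpose (incidence_matrix G) *v f = 0
      \<longleftrightarrow> (\<forall>e\<in>arcs G. f $ head G e = f $ tail G e)" for f
    by (simp add: vec_eq_iff incidence_matrix_transpose_nth[OF assms(1)] del: transpose_matrix_vector) blast
  have conn: "Digraph_Component.connected G \<longleftrightarrow> (\<forall>u w. u \<rightarrow>\<^sup>*\<^bsub>mk_symmetric G\<^esub> w)"
    by (simp add: connected_def strongly_connected_def assms(2))
  have adj: "(u, w) \<in> parcs (mk_symmetric G) \<longleftrightarrow>
      (\<exists>e\<in>arcs G. {u, w} = {tail G e, head G e})" for u w
    by (auto simp: mk_symmetric_def doubleton_eq_iff)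
  show ?thesis
  proof
    assume c: "Digraph_Component.connected G"
    show "\<forall>f. transpose (incidence_matrix G) *v f = 0 \<longrightarrow> (\<forall>u w. f $ u = f $ w)"
    proof (intro allI impI)
      fix f :: "real^'v" and u w
      assume "transpose (incidence_matrix G) *v f = 0"
      then have f: "f $ head G e = f $ tail G e" if "e \<in> arcs G" for e
        using ker that by blast
      have "u \<rightarrow>\<^sup>*\<^bsub>mk_symmetric G\<^esub> w" using c conn by blast
      then show "f $ u = f $ w"
      proof (induction rule: S.reachable_induct)
        case (step x y)
        then show ?case using f adj[of x y] by (auto simp: doubleton_eq_iff)
      qed simp
    qed
  next
    assume k: "\<forall>f. transpose (incidence_matrix G) *v f = 0 \<longrightarrow> (\<forall>u w. f $ u = f $ w)"
    show "Digraph_Component.connected G" unfolding conn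
    proof (intro allI)
      fix u w
      \<comment> \<open>The indicator of the component of \<open>u\<close> is in the kernel.\<close>
      define f :: "real^'v" where "f = (\<chi> i. if u \<rightarrow>\<^sup>*\<^bsub>mk_symmetric G\<^esub> i then 1 else 0)"
      have "u \<rightarrow>\<^sup>*\<^bsub>mk_symmetric G\<^esub> head G e \<longleftrightarrow> u \<rightarrow>\<^sup>*\<^bsub>mk_symmetric G\<^esub> tail G e" if "e \<in> arcs G" for e
      proof -
        have "(tail G e, head G e) \<in> parcs (mk_symmetric G)" "(head G e, tail G e) \<in> parcs (mk_symmetric G)"
          using that by (auto simp: mk_symmetric_def)
        then show ?thesis by (auto intro: S.reachable_adj_trans)
      qed
      then have "transpose (incidence_matrix G) *v f = 0"
        unfolding ker by (simp add: f_def)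
      then have "f $ u = f $ w" using k by blast
      moreover have "u \<rightarrow>\<^sup>*\<^bsub>mk_symmetric G\<^esub> u"
        by (rule S.reachable_refl) (simp add: mk_symmetric_def assms(2))
      ultimately show "u \<rightarrow>\<^sup>*\<^bsub>mk_symmetric G\<^esub> w" by (simp add: f_def split: if_splits)
    qed
  qed
qed

section \<open>Gradients of strictly convex functions\<close>

lemma gradient_eqI: "GDERIV f x :> g \<Longrightarrow> gradient f x = g"
proof -
  assume g: "GDERIV f x :> g"
  have "h = g" if "GDERIV f x :> h" for h
  proof -
    have "(\<lambda>v. v \<bullet> h) = (\<lambda>v. v \<bullet> g)"
      using that g unfolding gderiv_def by (rule has_derivative_unique)
    then show "h = g" by (metis vector_eq_ldot)
  qed
  then show ?thesis unfolding gradient_def using g by (intro the_equality)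
qed

lemma gderiv_gradient:
  fixes f :: "'a::euclidean_space \<Rightarrow> real"
  assumes "f differentiable (at x)"
  shows "GDERIV f x :> gradient f x"
proof -
  obtain D where D: "(f has_derivative D) (at x)"
    using assms by (auto simp: differentiable_def)
  interpret bounded_linear D using D by (rule has_derivative_bounded_linear)
  have "D = (\<lambda>h. h \<bullet> (\<Sum>b\<in>Basis. D b *\<^sub>R b))"
  proof
    fix h
    have "D h = D (\<Sum>b\<in>Basis. (h \<bullet> b) *\<^sub>R b)" by (simp add: euclidean_representation)
    also have "\<dots> = h \<bullet> (\<Sum>b\<in>Basis. D b *\<^sub>R b)"
      by (simp add: sum scaleR inner_sum_right mult.commute)
    finally show "D h = h \<bullet> (\<Sum>b\<in>Basis. D b *\<^sub>R b)" .
  qed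
  then have "GDERIV f x :> (\<Sum>b\<in>Basis. D b *\<^sub>R b)" using D by (simp add: gderiv_def)
  then show ?thesis using gradient_eqI by metis
qed

lemma gradient_H_c [simp]: "gradient H_c y = y"
proof (rule gradient_eqI)
  have "((\<lambda>y. 1 / 2 * (y \<bullet> y)) has_derivative (\<lambda>h. h \<bullet> y)) (at y)"
    by (auto simp: inner_commute intro!: derivative_eq_intros)
  then show "GDERIV H_c y :> y"
    by (simp add: gderiv_def H_c_def[abs_def] power2_norm_eq_inner)
qed

lemma has_derivative_along_line:
  assumes "(f has_derivative f') (at (a + s *\<^sub>R v))"
  shows "((\<lambda>s. f (a + s *\<^sub>R v)) has_derivative (\<lambda>h. f' (h *\<^sub>R v))) (at s)"
proof -
  have "((\<lambda>s. a + s *\<^sub>R v) has_derivative (\<lambda>h. h *\<^sub>R v)) (at s)"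
    by (auto intro!: derivative_eq_intros)
  then show ?thesis using assms by (rule has_derivative_compose)
qed

text \<open>
The mean value theorem, applied to the component of the gradient along the segment from \<open>y\<close> to \<open>x\<close>,
produces a value of the Hessian quadratic form at \<open>x - y\<close>, which is positive.
\<close>
lemma strictly_monotone_gradient:
  fixes H :: "real^'n \<Rightarrow> real"
  assumes "gradient H differentiable_on UNIV" and "\<And>x. positive_definite (hessian H x)"
    and "x \<noteq> y"
  shows "(gradient H x - gradient H y) \<bullet> (x - y) > 0"
proof -
  define v where "v = x - y"
  define \<phi> where "\<phi> s = gradient H (y + s *\<^sub>R v) \<bullet> v" for s
  have "(gradient H has_derivative (*v) (hessian H z)) (at z)" for z
  proof -
    have D: "(gradient H has_derivative frechet_derivative (gradient H) (at z)) (at z)"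
      using assms(1) by (simp add: differentiable_on_def flip: frechet_derivative_works)
    then show ?thesis
      unfolding hessian_def using matrix_works has_derivative_linear[OF D] by (simp add: fun_eq_iff)
  qed
  then have "(\<phi> has_derivative (\<lambda>h. (hessian H (y + s *\<^sub>R v) *v (h *\<^sub>R v)) \<bullet> v)) (at s)" for s
    unfolding \<phi>_def by (intro has_derivative_inner_left has_derivative_along_line)
  then have "\<exists>s\<in>{0<..<1}. \<phi> 1 - \<phi> 0 = (hessian H (y + s *\<^sub>R v) *v ((1 - 0) *\<^sub>R v)) \<bullet> v"
    by (intro mvt_simple) (auto intro: has_derivative_at_withinI)
  moreover have "(hessian H z *v v) \<bullet> v > 0" for z
    using assms(2,3) by (simp add: positive_definite_def v_def inner_commute)
  ultimately have "\<phi> 1 - \<phi> 0 > 0" by (metis diff_zero scaleR_one)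
  then show ?thesis by (simp add: \<phi>_def v_def inner_diff_left)
qed

text \<open>
On the unit sphere \<open>H\<close> exceeds \<open>H 0\<close> by a positive amount \<open>\<mu>\<close>, by compactness and strictness; convexity
along rays from the origin propagates this excess outwards at least linearly.
\<close>
lemma strictly_convex_linear_growth:
  fixes H :: "'a::euclidean_space \<Rightarrow> real"
  assumes "strictly_convex H" and "continuous_on UNIV H" and min: "\<And>x. H 0 \<le> H x"
  obtains \<mu> where "\<mu> > 0" "\<And>x. norm x \<ge> 1 \<Longrightarrow> H 0 + \<mu> * norm x \<le> H x"
proof -
  have conv: "H ((1 - u) *\<^sub>R x + u *\<^sub>R y) < (1 - u) * H x + u * H y"
    if "x \<noteq> y" "0 < u" "u < 1" for x y u
    using assms(1) that unfolding strictly_convex_def by blast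
  have "sphere 0 1 \<noteq> ({} :: 'a set)" by simp
  moreover have "continuous_on (sphere 0 1) H" using assms(2) by (rule continuous_on_subset) simp
  ultimately obtain e :: 'a where e: "e \<in> sphere 0 1" "\<And>y. y \<in> sphere 0 1 \<Longrightarrow> H e \<le> H y"
    using continuous_attains_inf[OF compact_sphere] by metis
  \<comment> \<open>If \<open>H e = H 0\<close>, the midpoint would lie strictly below the minimum.\<close>
  have "H 0 \<le> H ((1 - 1/2) *\<^sub>R 0 + (1/2) *\<^sub>R e)" by (rule min)
  also have "\<dots> < (1 - 1/2) * H 0 + 1/2 * H e" using e(1) by (intro conv) auto
  finally have pos: "H e - H 0 > 0" by simp
  have "H 0 + (H e - H 0) * norm x \<le> H x" if x: "norm x \<ge> 1" for x
  proof (cases "norm x = 1")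
    case True
    then show ?thesis using e(2)[of x] by simp
  next
    case False
    then have "norm x > 1" using x by simp
    have "H e \<le> H ((1 - 1 / norm x) *\<^sub>R 0 + (1 / norm x) *\<^sub>R x)" using x by (intro e(2)) auto
    also have "\<dots> < (1 - 1 / norm x) * H 0 + 1 / norm x * H x"
      using \<open>norm x > 1\<close> by (intro conv) (auto simp: divide_less_eq_1)
    finally have "H e - H 0 < (H x - H 0) / norm x" by (simp add: diff_divide_distrib algebra_simps)
    moreover have "0 < norm x" using \<open>norm x > 1\<close> by linarith
    ultimately have "(H e - H 0) * norm x < H x - H 0" by (simp only: pos_less_divide_eq)
    then show ?thesis by linarith
  qed
  then show ?thesis using that pos by blast
qed

lemma strictly_convex_bounded_sublevel:
  fixes H :: "'a::euclidean_space \<Rightarrow> real"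
  assumes "strictly_convex H" and "continuous_on UNIV H" and "\<And>x. H 0 \<le> H x"
  shows "bounded {x. H x \<le> c}"
proof -
  obtain \<mu> where \<mu>: "\<mu> > 0" "\<And>x. norm x \<ge> 1 \<Longrightarrow> H 0 + \<mu> * norm x \<le> H x"
    using strictly_convex_linear_growth[OF assms] by blast
  have "norm x \<le> max 1 ((c - H 0) / \<mu>)" if "H x \<le> c" for x
    using \<mu>(2)[of x] \<mu>(1) that by (cases "norm x \<ge> 1") (auto simp: field_simps le_max_iff_disj)
  then show ?thesis unfolding bounded_iff by blast
qed

lemma gradient_at_minimum:
  assumes "\<And>x. GDERIV H x :> g x" and "\<And>x. H a \<le> H x"
  shows "g a = 0"
proof -
  have "(\<lambda>h. h \<bullet> g a) = (\<lambda>h. 0)"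
    using assms unfolding gderiv_def by (intro differential_zero_maxmin[of a UNIV H] disjI2) auto
  then show "g a = 0" by (metis inner_eq_zero_iff)
qed

text \<open>
The point is a minimizer of \<open>H\<close> on the affine subspace \<open>p0 + range B\<close>, where the gradient is orthogonal
to \<open>range B\<close>. For the closed loop this yields an equilibrium with the same value of every conserved
quantity as \<open>p0\<close>.
\<close>
lemma stationary_point_along_range:
  fixes H :: "real^'v \<Rightarrow> real" and B :: "real^'e^'v"
  assumes sub: "\<And>c. bounded {x. H x \<le> c}" and diff: "H differentiable_on UNIV"
  obtains p z where "p = p0 + B *v z" "transpose B *v gradient H p = 0"
proof -
  have cont: "continuous_on UNIV H" using diff by (rule differentiable_imp_continuous_on)
  define A where "A = (+) p0 ` range ((*v) B)"
  have "closed (range ((*v) B))" by (intro closed_subspace linear_subspace_image) auto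
  then have "closed A" unfolding A_def by (rule closed_translation)
  define K where "K = A \<inter> {x. H x \<le> H p0}"
  have "p0 + B *v 0 \<in> A" unfolding A_def by blast
  then have "p0 \<in> K" by (simp add: K_def)
  have "closed {x. H x \<le> H p0}" using cont by (intro closed_Collect_le) auto
  then have "compact K" unfolding K_def compact_eq_bounded_closed
    using \<open>closed A\<close> sub by (auto intro: bounded_subset)
  moreover have "continuous_on K H" using cont by (rule continuous_on_subset) simp
  ultimately obtain p where p: "p \<in> K" "\<And>x. x \<in> K \<Longrightarrow> H p \<le> H x"
    using continuous_attains_inf[of K H] \<open>p0 \<in> K\<close> by (metis empty_iff)
  then have minA: "H p \<le> H x" if "x \<in> A" for x
    using that by (cases "H x \<le> H p0") (auto simp: K_def)
  obtain z where z: "p = p0 + B *v z" using p(1) by (auto simp: K_def A_def)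
  have "gradient H p \<bullet> (B *v y) = 0" for y
  proof -
    have "GDERIV H p :> gradient H p"
      using diff by (intro gderiv_gradient) (simp add: differentiable_on_def)
    then have "((\<lambda>s. H (p + s *\<^sub>R (B *v y))) has_derivative (\<lambda>h. (h *\<^sub>R (B *v y)) \<bullet> gradient H p)) (at 0)"
      unfolding gderiv_def by (intro has_derivative_along_line) simp
    moreover have inA: "p + s *\<^sub>R (B *v y) \<in> A" for s
    proof -
      have "p + s *\<^sub>R (B *v y) = p0 + B *v (z + s *\<^sub>R y)"
        by (simp add: z matrix_vector_right_distrib matrix_vector_mult_scaleR)
      then show ?thesis by (auto simp: A_def)
    qed
    ultimately have "(\<lambda>h. (h *\<^sub>R (B *v y)) \<bullet> gradient H p) = (\<lambda>h. 0)"
      by (intro differential_zero_maxmin[of 0 UNIV] disjI2) (auto intro!: minA inA)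
    then have "(1 *\<^sub>R (B *v y)) \<bullet> gradient H p = 0" by meson
    then show ?thesis by (simp add: inner_commute)
  qed
  then have "transpose B *v gradient H p = 0"
    by (metis inner_transpose_matrix_vector inner_eq_zero_iff)
  then show ?thesis using that z by blast
qed

section \<open>Functions on a half-line\<close>

lemma norm_increment_le:
  fixes f :: "real \<Rightarrow> 'a::real_inner"
  assumes "0 \<le> a" "a \<le> b"
    and der: "\<And>t. 0 \<le> t \<Longrightarrow> (f has_vector_derivative f' t) (at t within {0..})"
    and C: "\<And>t. a \<le> t \<Longrightarrow> t \<le> b \<Longrightarrow> norm (f' t) \<le> C"
  shows "norm (f b - f a) \<le> C * (b - a)"
proof (cases "a = b")
  case False
  then have "a < b" using \<open>a \<le> b\<close> by simp
  moreover have "continuous_on {0..} f"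
    using der by (auto simp: continuous_on_eq_continuous_within intro: has_vector_derivative_continuous)
  then have "continuous_on {a..b} f" by (rule continuous_on_subset) (use \<open>0 \<le> a\<close> in auto)
  moreover have "(f has_derivative (\<lambda>h. h *\<^sub>R f' t)) (at t)" if "a < t" for t
  proof -
    have "t \<in> interior {0..}" "0 \<le> t" using \<open>0 \<le> a\<close> that by simp_all
    then have "(f has_vector_derivative f' t) (at t)"
      using der[of t] by (simp only: at_within_interior)
    then show ?thesis by (simp only: has_vector_derivative_def)
  qed
  ultimately obtain t where t: "t \<in> {a<..<b}" "norm (f b - f a) \<le> norm ((b - a) *\<^sub>R f' t)"
    using mvt_general[of a b f "\<lambda>t h. h *\<^sub>R f' t"] by auto
  have "norm ((b - a) *\<^sub>R f' t) \<le> C * (b - a)"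
    using C[of t] t(1) by (simp add: mult.commute mult_left_mono)
  then show ?thesis using t(2) by linarith
qed simp

lemma dissipation_bound:
  fixes V :: "real \<Rightarrow> real" and w :: "real \<Rightarrow> 'a::real_normed_vector"
  assumes V: "\<And>t. 0 \<le> t \<Longrightarrow> (V has_real_derivative - (norm (w t))\<^sup>2) (at t within {0..})"
    and "0 \<le> s" "s \<le> t" "0 \<le> m" "\<And>r. s \<le> r \<Longrightarrow> r \<le> t \<Longrightarrow> m \<le> norm (w r)"
  shows "m\<^sup>2 * (t - s) \<le> V s - V t"
proof -
  have "(V has_derivative (*) (- (norm (w r))\<^sup>2)) (at r within {s..t})" if "s \<le> r" for r
  proof -
    have "(V has_real_derivative - (norm (w r))\<^sup>2) (at r within {s..t})"
      by (rule DERIV_subset[OF V]) (use \<open>0 \<le> s\<close> that in auto)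
    then show ?thesis by (simp only: has_field_derivative_def)
  qed
  then obtain r where r: "r \<in> {s..t}" "V t - V s = - (norm (w r))\<^sup>2 * (t - s)"
    using mvt_very_simple[of s t V "\<lambda>r. (*) (- (norm (w r))\<^sup>2)"] \<open>s \<le> t\<close> by auto
  have "m\<^sup>2 * (t - s) \<le> (norm (w r))\<^sup>2 * (t - s)"
    using r(1) assms by (intro mult_right_mono power_mono) auto
  then show ?thesis using r(2) by simp
qed

text \<open>
A form of Barbalat's lemma. The energy \<open>V\<close> is nonincreasing and bounded below, so late time intervals of a
fixed length dissipate arbitrarily little. If \<open>w\<close> were large at a late time, uniform continuity would keep
it large for a fixed time span and force a definite loss of energy.
\<close>
lemma dissipation_rate_tendsto_0:
  fixes V :: "real \<Rightarrow> real" and w :: "real \<Rightarrow> 'a::real_normed_vector"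
  assumes V: "\<And>t. 0 \<le> t \<Longrightarrow> (V has_real_derivative - (norm (w t))\<^sup>2) (at t within {0..})"
    and lower: "\<And>t. 0 \<le> t \<Longrightarrow> c \<le> V t"
    and uc: "uniformly_continuous_on {0..} w"
  shows "(w \<longlongrightarrow> 0) at_top"
proof -
  note drop = dissipation_bound[of V w, OF V]
  have bdd: "bdd_below (V ` {0..})" using lower by (intro bdd_belowI2[of _ c]) auto
  define L where "L = Inf (V ` {0..})"
  have L: "L \<le> V t" if "0 \<le> t" for t
    unfolding L_def using bdd that by (intro cInf_lower) auto
  show ?thesis
  proof (rule tendstoI)
    fix \<epsilon> :: real assume "\<epsilon> > 0"
    then obtain \<delta> where \<delta>: "\<delta> > 0"
      "\<And>s t. 0 \<le> s \<Longrightarrow> 0 \<le> t \<Longrightarrow> dist s t < \<delta> \<Longrightarrow> dist (w s) (w t) < \<epsilon> / 2"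
      using uc unfolding uniformly_continuous_on_def by (metis atLeast_iff half_gt_zero)
    \<comment> \<open>A lower bound for the energy lost while \<open>w\<close> has norm at least \<open>\<epsilon> / 2\<close> during a time span \<open>\<delta> / 2\<close>.\<close>
    define \<eta> where "\<eta> = (\<epsilon> / 2)\<^sup>2 * (\<delta> / 2)"
    have "\<eta> > 0" using \<open>\<epsilon> > 0\<close> \<delta>(1) by (simp add: \<eta>_def)
    then have "Inf (V ` {0..}) < L + \<eta>" by (simp add: L_def)
    then obtain T where T: "0 \<le> T" "V T < L + \<eta>"
      using cInf_lessD[of "V ` {0..}" "L + \<eta>"] by auto
    have "norm (w t) < \<epsilon>" if "T \<le> t" for t
    proof (rule ccontr)
      assume "\<not> norm (w t) < \<epsilon>"
      have "\<epsilon> / 2 \<le> norm (w r)" if "t \<le> r" "r \<le> t + \<delta> / 2" for r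
      proof -
        have "dist (w t) (w r) < \<epsilon> / 2"
          using that T(1) \<open>T \<le> t\<close> \<delta>(1) by (intro \<delta>(2)) (auto simp: dist_real_def)
        then have "norm (w t) - norm (w r) < \<epsilon> / 2"
          using norm_triangle_ineq2[of "w t" "w r"] by (simp add: dist_norm)
        then show ?thesis using \<open>\<not> norm (w t) < \<epsilon>\<close> by simp
      qed
      then have "\<eta> \<le> V t - V (t + \<delta> / 2)"
        using drop[of t "t + \<delta> / 2" "\<epsilon> / 2"] T(1) \<open>T \<le> t\<close> \<delta>(1) \<open>\<epsilon> > 0\<close> by (simp add: \<eta>_def)
      moreover have "V t \<le> V T" using drop[of T t 0] T(1) \<open>T \<le> t\<close> by simp
      moreover have "L \<le> V (t + \<delta> / 2)" using L T(1) \<open>T \<le> t\<close> \<delta>(1) by simp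
      ultimately show False using T(2) by simp
    qed
    then show "\<forall>\<^sub>F t in at_top. dist (w t) 0 < \<epsilon>"
      unfolding eventually_at_top_linorder by auto
  qed
qed

lemma infdist_tendsto_0_if_limit_points:
  fixes z :: "real \<Rightarrow> 'a::heine_borel"
  assumes bdd: "bounded (z ` {0..})"
    and lim: "\<And>t l. (\<And>n. 0 \<le> t n) \<Longrightarrow> filterlim t at_top sequentially \<Longrightarrow>
      (\<lambda>n::nat. z (t n)) \<longlonglongrightarrow> l \<Longrightarrow> l \<in> S"
  shows "((\<lambda>t. infdist (z t) S) \<longlongrightarrow> 0) at_top"
proof (rule ccontr)
  assume "\<not> ?thesis"
  then obtain \<epsilon> where "\<epsilon> > 0" and "\<not> (\<forall>\<^sub>F t in at_top. dist (infdist (z t) S) 0 < \<epsilon>)"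
    unfolding tendsto_iff by blast
  then have "\<exists>t\<ge>T. \<epsilon> \<le> infdist (z t) S" for T
    unfolding eventually_at_top_linorder by (force simp: not_less infdist_nonneg)
  then have "\<forall>n::nat. \<exists>t. real n \<le> t \<and> \<epsilon> \<le> infdist (z t) S" by blast
  then obtain t where t: "\<And>n::nat. real n \<le> t n" "\<And>n. \<epsilon> \<le> infdist (z (t n)) S"
    by metis
  have t0: "0 \<le> t n" for n using t(1)[of n] by linarith
  have "bounded (range (\<lambda>n. z (t n)))" using bdd by (rule bounded_subset) (use t0 in auto)
  then obtain l r where r: "strict_mono r" and l: "((\<lambda>n. z (t n)) \<circ> r) \<longlonglongrightarrow> l"
    using bounded_imp_convergent_subsequence by blast
  have l': "(\<lambda>n. z (t (r n))) \<longlonglongrightarrow> l" using l by (simp add: o_def)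
  have "filterlim t at_top sequentially"
    by (rule filterlim_at_top_mono[OF filterlim_real_sequentially]) (simp add: t(1))
  then have "filterlim (\<lambda>n. t (r n)) at_top sequentially"
    by (rule filterlim_compose) (rule filterlim_subseq[OF r])
  then have "l \<in> S" using lim[of "\<lambda>n. t (r n)"] t0 l' by blast
  have "(\<lambda>n. infdist (z (t (r n))) S) \<longlonglongrightarrow> infdist l S" using l' by (rule tendsto_infdist)
  then have "\<epsilon> \<le> infdist l S" by (rule Lim_bounded2[where N=0]) (simp add: t(2))
  then show False using \<open>\<epsilon> > 0\<close> \<open>l \<in> S\<close> by simp
qed

section \<open>The closed loop in deviation coordinates\<close>

text \<open>
The state is measured from an equilibrium: \<open>p\<close> is the deviation of the vertex state from its
desired value, \<open>q\<close> that of the controller state from a value that cancels the disturbance. A single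
solution is fixed instead of a flow, because a differentiable gradient need not be locally Lipschitz and
the usual uniqueness theorem does not apply.
\<close>
locale damped_flow =
  fixes B :: "real^'e^'v" and H :: "real^'v \<Rightarrow> real" and g :: "real^'v \<Rightarrow> real^'v"
    and p :: "real \<Rightarrow> real^'v" and q :: "real \<Rightarrow> real^'e"
  assumes gderiv: "\<And>x. GDERIV H x :> g x"
    and g_continuous: "continuous_on UNIV g"
    and g_strictly_monotone: "\<And>x y. x \<noteq> y \<Longrightarrow> (g x - g y) \<bullet> (x - y) > 0"
    and H_min: "\<And>x. H 0 \<le> H x"
    and H_sublevel: "\<And>c. bounded {x. H x \<le> c}"
    and p_deriv: "\<And>t. 0 \<le> t \<Longrightarrow>
      (p has_vector_derivative - (B *v (transpose B *v g (p t))) - B *v q t) (at t within {0..})"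
    and q_deriv: "\<And>t. 0 \<le> t \<Longrightarrow>
      (q has_vector_derivative transpose B *v g (p t)) (at t within {0..})"
begin

definition effort_gap :: "real \<Rightarrow> real^'e" where "effort_gap t = transpose B *v g (p t)"

definition energy :: "real \<Rightarrow> real" where "energy t = H (p t) + 1 / 2 * (q t \<bullet> q t)"

text \<open>
The coupling terms between \<open>p\<close> and \<open>q\<close> are skew-symmetric and cancel; only the damping remains.
\<close>
lemma energy_deriv:
  assumes "0 \<le> t"
  shows "(energy has_real_derivative - (norm (effort_gap t))\<^sup>2) (at t within {0..})"
proof -
  have "((\<lambda>t. H (p t)) has_derivative (\<lambda>h. (h *\<^sub>R (- (B *v effort_gap t) - B *v q t)) \<bullet> g (p t)))
      (at t within {0..})"
    using p_deriv[OF assms] gderiv[of "p t"] unfolding gderiv_def has_vector_derivative_def effort_gap_def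
    by (rule has_derivative_compose)
  moreover have "((\<lambda>t. q t \<bullet> q t) has_derivative (\<lambda>h. q t \<bullet> (h *\<^sub>R effort_gap t) + (h *\<^sub>R effort_gap t) \<bullet> q t))
      (at t within {0..})"
    using q_deriv[OF assms] unfolding has_vector_derivative_def effort_gap_def
    by (intro has_derivative_inner)
  ultimately have "(energy has_derivative (\<lambda>h. (h *\<^sub>R (- (B *v effort_gap t) - B *v q t)) \<bullet> g (p t)
      + 1 / 2 * (q t \<bullet> (h *\<^sub>R effort_gap t) + (h *\<^sub>R effort_gap t) \<bullet> q t))) (at t within {0..})"
    unfolding energy_def by (intro has_derivative_add has_derivative_mult_right)
  moreover have "(h *\<^sub>R (- (B *v effort_gap t) - B *v q t)) \<bullet> g (p t)
      + 1 / 2 * (q t \<bullet> (h *\<^sub>R effort_gap t) + (h *\<^sub>R effort_gap t) \<bullet> q t) = - (norm (effort_gap t))\<^sup>2 * h" for h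
  proof -
    have "(B *v y) \<bullet> g (p t) = y \<bullet> effort_gap t" for y
      unfolding effort_gap_def by (metis inner_transpose_matrix_vector inner_commute)
    then show ?thesis
      by (simp add: inner_diff_left inner_commute[of "effort_gap t" "q t"] power2_norm_eq_inner algebra_simps)
  qed
  ultimately show ?thesis by (simp only: has_field_derivative_def)
qed

lemma energy_le: "0 \<le> t \<Longrightarrow> energy t \<le> energy 0"
  using dissipation_bound[OF energy_deriv, of 0 t 0] by simp

lemma bounded_p: "bounded (p ` {0..})"
proof (rule bounded_subset[OF H_sublevel[of "energy 0"]])
  show "p ` {0..} \<subseteq> {x. H x \<le> energy 0}"
  proof clarsimp
    fix t :: real assume "0 \<le> t"
    have "0 \<le> q t \<bullet> q t" by simp
    then show "H (p t) \<le> energy 0" using energy_le[OF \<open>0 \<le> t\<close>] unfolding energy_def by linarith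
  qed
qed

lemma bounded_q: "bounded (q ` {0..})"
proof -
  have "norm (q t) \<le> sqrt (2 * (energy 0 - H 0))" if "0 \<le> t" for t
  proof (rule real_le_rsqrt)
    have "1 / 2 * (q t \<bullet> q t) \<le> energy 0 - H 0"
      using energy_le[OF that] H_min[of "p t"] energy_def[of t] by linarith
    then show "(norm (q t))\<^sup>2 \<le> 2 * (energy 0 - H 0)"
      by (simp add: power2_norm_eq_inner)
  qed
  then show ?thesis unfolding bounded_iff by auto
qed

lemma compact_closure_p: "compact (closure (p ` {0..}))"
  using bounded_p by (simp add: compact_closure)

lemma g_uniformly_continuous: "uniformly_continuous_on (closure (p ` {0..})) g"
  using continuous_on_subset[OF g_continuous] compact_closure_p
  by (intro compact_uniformly_continuous) auto

text \<open>
Bounded solutions have bounded velocity, so they are Lipschitz.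
\<close>
lemma p_uniformly_continuous: "uniformly_continuous_on {0..} p"
proof -
  have "bounded (g ` closure (p ` {0..}))"
    using compact_closure_p continuous_on_subset[OF g_continuous]
    by (intro compact_imp_bounded compact_continuous_image) auto
  then have g: "bounded ((\<lambda>t. g (p t)) ` {0..})"
    by (rule bounded_subset) (use closure_subset[of "p ` {0..}"] in auto)
  have "bounded ((*v) B ` (*v) (transpose B) ` (\<lambda>t. g (p t)) ` {0..})"
    by (intro bounded_linear_image g matrix_vector_mul_bounded_linear)
  then obtain C1 where C1: "C1 > 0" "\<And>t. 0 \<le> t \<Longrightarrow> norm (B *v (transpose B *v g (p t))) \<le> C1"
    unfolding bounded_pos by blast
  have "bounded ((*v) B ` q ` {0..})"
    by (intro bounded_linear_image bounded_q matrix_vector_mul_bounded_linear)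
  then obtain C2 where C2: "C2 > 0" "\<And>t. 0 \<le> t \<Longrightarrow> norm (B *v q t) \<le> C2"
    unfolding bounded_pos by blast
  define C where "C = C1 + C2"
  have C: "norm (- (B *v (transpose B *v g (p t))) - B *v q t) \<le> C" if "0 \<le> t" for t
    using norm_triangle_ineq4[of "- (B *v (transpose B *v g (p t)))" "B *v q t"]
      C1(2)[OF that] C2(2)[OF that]
    unfolding C_def norm_minus_cancel by linarith
  have lip: "norm (p t - p s) \<le> C * (t - s)" if "0 \<le> s" "s \<le> t" for s t
    using that p_deriv by (rule norm_increment_le) (use C that in auto)
  have "C-lipschitz_on {0..} p"
  proof (rule lipschitz_onI)
    fix s t :: real assume "s \<in> {0..}" "t \<in> {0..}"
    then show "dist (p s) (p t) \<le> C * dist s t"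
      using lip[of s t] lip[of t s] by (cases "s \<le> t") (auto simp: dist_norm norm_minus_commute)
  qed (use C1(1) C2(1) in \<open>simp add: C_def\<close>)
  then show ?thesis by (rule lipschitz_on_uniformly_continuous)
qed

lemma effort_gap_tendsto_0: "(effort_gap \<longlongrightarrow> 0) at_top"
proof (rule dissipation_rate_tendsto_0[of energy])
  have "uniformly_continuous_on {0..} (\<lambda>t. g (p t))"
    using p_uniformly_continuous
  proof (rule uniformly_continuous_on_compose)
    show "uniformly_continuous_on (p ` {0..}) g"
      using g_uniformly_continuous closure_subset[of "p ` {0..}"]
      unfolding uniformly_continuous_on_def by fast
  qed
  then show "uniformly_continuous_on {0..} effort_gap"
    unfolding effort_gap_def[abs_def] using matrix_vector_mul_bounded_linear
    by (rule bounded_linear.uniformly_continuous_on[rotated])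
  show "H 0 \<le> energy t" for t
    using H_min[of "p t"] inner_ge_zero[of "q t"] unfolding energy_def by linarith
qed (rule energy_deriv)

text \<open>
Once the effort gap is small, \<open>q\<close> hardly moves during one unit of time and \<open>p\<close> drifts with the almost
constant velocity \<open>- (B *v q t)\<close>.
\<close>
lemma unit_step_tendsto: "((\<lambda>t. p (t + 1) - p t + B *v q t) \<longlongrightarrow> 0) at_top"
proof (rule tendstoI)
  fix \<epsilon> :: real assume "\<epsilon> > 0"
  obtain K where K: "K > 0" "\<And>y. norm (B *v y) \<le> norm y * K"
    using bounded_linear.pos_bounded[OF matrix_vector_mul_bounded_linear[of B]] by blast
  define \<eta> where "\<eta> = \<epsilon> / (4 * K)"
  have "\<eta> > 0" using \<open>\<epsilon> > 0\<close> K(1) by (simp add: \<eta>_def)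
  then have "\<forall>\<^sub>F t in at_top. norm (effort_gap t) < \<eta>"
    using tendstoD[OF effort_gap_tendsto_0] by simp
  then obtain T0 where T0: "\<And>t. T0 \<le> t \<Longrightarrow> norm (effort_gap t) < \<eta>"
    unfolding eventually_at_top_linorder by blast
  define T where "T = max T0 0"
  have "norm (p (t + 1) - p t + B *v q t) < \<epsilon>" if "T \<le> t" for t
  proof -
    have t: "0 \<le> t" "T0 \<le> t" using that by (auto simp: T_def)
    have qs: "norm (q s - q t) \<le> \<eta>" if "t \<le> s" "s \<le> t + 1" for s
    proof -
      have "norm (q s - q t) \<le> \<eta> * (s - t)"
        using t(1) that(1) q_deriv
      proof (rule norm_increment_le)
        fix r assume "t \<le> r"
        then show "norm (transpose B *v g (p r)) \<le> \<eta>"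
          using T0[of r] t(2) unfolding effort_gap_def by simp
      qed
      also have "\<dots> \<le> \<eta> * 1" using that \<open>\<eta> > 0\<close> by (intro mult_left_mono) auto
      finally show ?thesis by simp
    qed
    \<comment> \<open>The drift is removed from \<open>p\<close>, and a small derivative is left.\<close>
    define f where "f s = p s + s *\<^sub>R (B *v q t)" for s
    have "norm (f (t + 1) - f t) \<le> (2 * \<eta> * K) * ((t + 1) - t)"
    proof (rule norm_increment_le)
      fix s :: real assume "0 \<le> s"
      have "((\<lambda>s. s *\<^sub>R (B *v q t)) has_vector_derivative B *v q t) (at s within {0..})"
        by (auto intro!: derivative_eq_intros simp: has_vector_derivative_def)
      then have "(f has_vector_derivative (- (B *v effort_gap s) - B *v q s) + B *v q t) (at s within {0..})"
        unfolding f_def using p_deriv[OF \<open>0 \<le> s\<close>] unfolding effort_gap_def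
        by (intro has_vector_derivative_add)
      moreover have "(- (B *v effort_gap s) - B *v q s) + B *v q t = - (B *v (effort_gap s + (q s - q t)))"
        by (simp add: matrix_vector_right_distrib matrix_vector_mult_diff_distrib)
      ultimately show "(f has_vector_derivative - (B *v (effort_gap s + (q s - q t)))) (at s within {0..})"
        by simp
    next
      fix s assume s: "t \<le> s" "s \<le> t + 1"
      have "norm (effort_gap s + (q s - q t)) \<le> 2 * \<eta>"
        using norm_triangle_ineq[of "effort_gap s" "q s - q t"] qs[OF s] T0[of s] s t(2) by simp
      then have "norm (effort_gap s + (q s - q t)) * K \<le> 2 * \<eta> * K"
        using K(1) by (intro mult_right_mono) auto
      then show "norm (- (B *v (effort_gap s + (q s - q t)))) \<le> 2 * \<eta> * K"
        using K(2)[of "effort_gap s + (q s - q t)"] by simp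
    qed (use t in auto)
    also have "\<dots> < \<epsilon>" using \<open>\<epsilon> > 0\<close> K(1) by (simp add: \<eta>_def)
    also have "f (t + 1) - f t = p (t + 1) - p t + B *v q t"
      by (simp add: f_def algebra_simps)
    finally show ?thesis .
  qed
  then show "\<forall>\<^sub>F t in at_top. dist (p (t + 1) - p t + B *v q t) 0 < \<epsilon>"
    unfolding eventually_at_top_linorder by auto
qed

text \<open>
This replaces LaSalle's invariance principle. If \<open>(a, b)\<close> is a limit point, then \<open>a - B *v b\<close>
is also a limit point of \<open>p\<close>, reached one unit of time later. The effort gap vanishes at both, so the
difference of their gradients is orthogonal to their difference \<open>B *v b\<close>. Strict monotonicity of the
gradient leaves only \<open>B *v b = 0\<close>.
\<close>
lemma limit_point_stationary:
  assumes t: "filterlim t at_top sequentially"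
    and a: "(\<lambda>n::nat. p (t n)) \<longlonglongrightarrow> a" and b: "(\<lambda>n. q (t n)) \<longlonglongrightarrow> b"
  shows "transpose B *v g a = 0" and "B *v b = 0"
proof -
  have ker: "transpose B *v g c = 0"
    if "filterlim s at_top sequentially" "(\<lambda>n::nat. p (s n)) \<longlonglongrightarrow> c" for s c
  proof -
    have "isCont g c" using g_continuous by (simp add: continuous_on_eq_continuous_at)
    then have "(\<lambda>n. g (p (s n))) \<longlonglongrightarrow> g c" using that(2) by (rule isCont_tendsto_compose)
    then have "(\<lambda>n. effort_gap (s n)) \<longlonglongrightarrow> transpose B *v g c"
      unfolding effort_gap_def by (rule bounded_linear.tendsto[OF matrix_vector_mul_bounded_linear])
    moreover have "(\<lambda>n. effort_gap (s n)) \<longlonglongrightarrow> 0"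
      using effort_gap_tendsto_0 that(1) by (rule filterlim_compose)
    ultimately show ?thesis by (rule LIMSEQ_unique)
  qed
  show 1: "transpose B *v g a = 0" using t a by (rule ker)
  have "(\<lambda>n. p (t n + 1) - p (t n) + B *v q (t n)) \<longlonglongrightarrow> 0"
    using unit_step_tendsto t by (rule filterlim_compose)
  moreover have "(\<lambda>n. B *v q (t n)) \<longlonglongrightarrow> B *v b"
    using b by (rule bounded_linear.tendsto[OF matrix_vector_mul_bounded_linear])
  ultimately have "(\<lambda>n. (p (t n + 1) - p (t n) + B *v q (t n)) + p (t n) - B *v q (t n))
      \<longlonglongrightarrow> 0 + a - B *v b"
    using a by (intro tendsto_intros)
  then have "(\<lambda>n. p (t n + 1)) \<longlonglongrightarrow> a - B *v b" by simp
  moreover have "filterlim (\<lambda>n. t n + 1) at_top sequentially"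
    using t by (rule filterlim_at_top_mono) simp
  ultimately have 2: "transpose B *v g (a - B *v b) = 0" by (intro ker[of "\<lambda>n. t n + 1"])
  have "(g a - g (a - B *v b)) \<bullet> (a - (a - B *v b)) = (transpose B *v (g a - g (a - B *v b))) \<bullet> b"
    by (simp only: inner_transpose_matrix_vector) simp
  also have "\<dots> = 0" by (simp only: matrix_vector_mult_diff_distrib 1 2) simp
  finally have "a = a - B *v b" using g_strictly_monotone[of a "a - B *v b"] by (metis less_irrefl)
  then show "B *v b = 0" by simp
qed

text \<open>
The velocity of \<open>p\<close> lies in the range of \<open>B\<close>, to which \<open>f\<close> is orthogonal.
\<close>
lemma inner_p_conserved:
  assumes "transpose B *v f = 0" and "0 \<le> t"
  shows "f \<bullet> p t = f \<bullet> p 0"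
proof -
  have "norm (f \<bullet> p t - f \<bullet> p 0) \<le> 0 * (t - 0)"
  proof (rule norm_increment_le)
    fix s :: real assume "0 \<le> s"
    have "f \<bullet> (B *v y) = 0" for y
      unfolding inner_transpose_matrix_vector[symmetric] assms(1) by (rule inner_zero_left)
    then have "f \<bullet> (- (B *v (transpose B *v g (p s))) - B *v q s) = 0"
      by (simp add: inner_diff_right)
    with bounded_linear.has_vector_derivative[OF bounded_linear_inner_right[of f] p_deriv[OF \<open>0 \<le> s\<close>]]
    show "((\<lambda>t. f \<bullet> p t) has_vector_derivative 0) (at s within {0..})" by (simp only:)
  qed (use \<open>0 \<le> t\<close> in auto)
  then show ?thesis by simp
qed

end

section \<open>Convergence and weak connectedness\<close>

lemma closed_edge_space: "closed (edge_space G)"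
proof -
  have "edge_space G = (\<Inter>e\<in>- arcs G. {y. y $ e = 0})"
    by (auto simp: edge_space_def)
  moreover have "closed {y :: real^'e. y $ e = 0}" for e
    by (intro closed_Collect_eq continuous_intros)
  ultimately show ?thesis by auto
qed

text \<open>
Shifting the controller state by the point from the matching condition absorbs the disturbance.
\<close>
lemma closed_loop_shifted:
  assumes "E *v d = incidence_matrix G *v yb"
  shows "closed_loop G H E d xs z =
    (- (incidence_matrix G *v (transpose (incidence_matrix G) *v gradient H (fst z - xs)))
       - incidence_matrix G *v (snd z - yb),
     transpose (incidence_matrix G) *v gradient H (fst z - xs))"
proof -
  have neg: "(- A) *v y = - (A *v y)" for A :: "real^'n^'m" and y
    by (simp add: vec_eq_iff matrix_vector_mult_def sum_negf)
  show ?thesis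
    unfolding closed_loop_def Let_def case_prod_beta gradient_H_c assms neg
      matrix_vector_mul_assoc matrix_vector_mult_diff_distrib
    by simp
qed

text \<open>
A limit point \<open>a\<close> of the deviation has a gradient in the kernel of the transposed incidence matrix, that is,
a multiple of the all-ones vector, while \<open>a\<close> itself has component sum zero by conservation. So \<open>a\<close> is
orthogonal to the gradient at \<open>a\<close>; the gradient at the origin vanishes, and strict monotonicity forces
\<open>a = 0\<close>.
\<close>
lemma connected_imp_convergence:
  fixes G :: "('v::finite, 'e::finite) pre_digraph" and H :: "real^'v \<Rightarrow> real"
  assumes "loopfree_digraph G" and "verts G = UNIV" and conn: "Digraph_Component.connected G"
    and conv: "strictly_convex H" and diff: "twice_differentiable H"
    and pd: "\<And>x. positive_definite (hessian H x)" and H_min: "\<And>x. H 0 \<le> H x"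
    and match: "matching_condition G E d"
    and traj: "trajectory G H E d xs z" and adm: "xs \<in> admissible (fst (z 0))"
  shows "((\<lambda>t. infdist (z t) (E_tot G E d xs)) \<longlongrightarrow> 0) at_top"
proof -
  define B where "B = incidence_matrix G"
  obtain yb where yb: "E *v d = B *v yb"
    using match by (auto simp: matching_condition_def B_def)
  define p where "p t = fst (z t) - xs" for t
  define q where "q t = snd (z t) - yb" for t
  have diff1: "H differentiable_on UNIV" and diff2: "gradient H differentiable_on UNIV"
    using diff by (auto simp: twice_differentiable_def)
  have z: "(z has_vector_derivative (- (B *v (transpose B *v gradient H (p t))) - B *v q t,
      transpose B *v gradient H (p t))) (at t within {0..})" if "0 \<le> t" for t
    using traj that closed_loop_shifted[OF yb[unfolded B_def], of H xs "z t"]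
    unfolding trajectory_def p_def q_def B_def by metis
  interpret damped_flow B H "gradient H" p q
  proof
    show "GDERIV H x :> gradient H x" for x
      using diff1 by (intro gderiv_gradient) (simp add: differentiable_on_def)
    show "continuous_on UNIV (gradient H)" using diff2 by (rule differentiable_imp_continuous_on)
    show "(gradient H x - gradient H y) \<bullet> (x - y) > 0" if "x \<noteq> y" for x y
      using diff2 pd that by (rule strictly_monotone_gradient)
    show "bounded {x. H x \<le> c}" for c
      using conv differentiable_imp_continuous_on[OF diff1] H_min
      by (rule strictly_convex_bounded_sublevel)
    fix t :: real assume "0 \<le> t"
    note z = z[OF this]
    have "((\<lambda>t. fst (z t)) has_vector_derivative - (B *v (transpose B *v gradient H (p t))) - B *v q t)
        (at t within {0..})"
      using bounded_linear.has_vector_derivative[OF bounded_linear_fst z] by (simp only: fst_conv)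
    then show "(p has_vector_derivative - (B *v (transpose B *v gradient H (p t))) - B *v q t)
        (at t within {0..})"
      unfolding p_def[abs_def] by (simp only: has_vector_derivative_diff_const)
    have "((\<lambda>t. snd (z t)) has_vector_derivative transpose B *v gradient H (p t)) (at t within {0..})"
      using bounded_linear.has_vector_derivative[OF bounded_linear_snd z] by (simp only: snd_conv)
    then show "(q has_vector_derivative transpose B *v gradient H (p t)) (at t within {0..})"
      unfolding q_def[abs_def] by (simp only: has_vector_derivative_diff_const)
  qed (rule H_min)
  have ker: "\<exists>c. f = c *\<^sub>R 1" if "transpose B *v f = 0" for f
  proof
    fix i
    show "f = f $ i *\<^sub>R 1"
      using connected_iff_incidence_kernel_constant[OF assms(1,2)] conn that
      unfolding B_def by (simp add: vec_eq_iff)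
  qed
  have ones: "1 \<bullet> p 0 = 0"
    using adm by (simp add: admissible_def p_def inner_vec_def sum_subtractf)
  show ?thesis
  proof (rule infdist_tendsto_0_if_limit_points)
    have "z = (\<lambda>t. (p t, q t) + (xs, yb))" by (simp add: p_def q_def fun_eq_iff prod_eq_iff)
    moreover have "bounded ((\<lambda>t. (p t, q t)) ` {0..})"
      by (rule bounded_subset[OF bounded_Times[OF bounded_p bounded_q]]) auto
    moreover have "bounded ((\<lambda>t. (xs, yb)) ` {0 :: real..})" by (rule bounded_subset[of "{(xs, yb)}"]) auto
    ultimately show "bounded (z ` {0..})" by (simp only: bounded_plus_comp)
  next
    fix t l assume t0: "\<And>n::nat. (0::real) \<le> t n" and t: "filterlim t at_top sequentially"
      and l: "(\<lambda>n. z (t n)) \<longlonglongrightarrow> l"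
    define a where "a = fst l - xs"
    define b where "b = snd l - yb"
    have a: "(\<lambda>n. p (t n)) \<longlonglongrightarrow> a" unfolding p_def a_def by (intro tendsto_intros l)
    have b: "(\<lambda>n. q (t n)) \<longlonglongrightarrow> b" unfolding q_def b_def by (intro tendsto_intros l)
    have "transpose B *v gradient H a = 0" and Bb: "B *v b = 0"
      by (rule limit_point_stationary[OF t a b])+
    have "transpose B *v 1 = 0"
      unfolding B_def vec_eq_iff incidence_matrix_transpose_nth[OF assms(1)] by simp
    then have "1 \<bullet> p (t n) = 0" for n using inner_p_conserved[OF _ t0] ones by simp
    moreover have "(\<lambda>n. 1 \<bullet> p (t n)) \<longlonglongrightarrow> 1 \<bullet> a" by (intro tendsto_intros a)
    ultimately have "1 \<bullet> a = 0" by (simp add: LIMSEQ_const_iff)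
    moreover obtain c where "gradient H a = c *\<^sub>R 1"
      using ker \<open>transpose B *v gradient H a = 0\<close> by blast
    ultimately have "gradient H a \<bullet> a = 0" by (metis inner_scaleR_left mult_zero_right)
    moreover have "gradient H 0 = 0"
      using gderiv H_min by (rule gradient_at_minimum)
    ultimately have "(gradient H a - gradient H 0) \<bullet> (a - 0) = 0" by simp
    then have "a = 0" using g_strictly_monotone[of a 0] by (metis less_irrefl)
    then have "fst l = xs" by (simp add: a_def)
    moreover have "snd l \<in> edge_space G"
    proof (rule Lim_in_closed_set[OF closed_edge_space _ _ tendsto_snd[OF l]])
      show "\<forall>\<^sub>F n in sequentially. snd (z (t n)) \<in> edge_space G"
        using traj t0 by (simp add: trajectory_def)
    qed simp
    moreover have "B *v snd l = E *v d"
      using Bb unfolding yb b_def by (simp add: matrix_vector_mult_diff_distrib)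
    ultimately show "l \<in> E_tot G E d xs"
      unfolding E_tot_def B_def by (cases l) simp
  qed
qed

text \<open>
If the graph is disconnected, some kernel vector \<open>f\<close> differs at two vertices \<open>u\<close> and \<open>v\<close>. Mass is moved
from \<open>v\<close> to \<open>u\<close>, which preserves the total but changes the inner product with \<open>f\<close>; relaxing inside the
components then gives an equilibrium \<open>p\<close> other than the origin. The constant trajectory at that point is
admissible and keeps distance at least \<open>norm p\<close> from the target set.
\<close>
lemma convergence_imp_connected:
  fixes G :: "('v::finite, 'e::finite) pre_digraph" and H :: "real^'v \<Rightarrow> real"
  assumes "loopfree_digraph G" and "verts G = UNIV"
    and conv: "strictly_convex H" and diff: "H differentiable_on UNIV" and H_min: "\<And>x. H 0 \<le> H x"
    and match: "matching_condition G E d"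
    and lim: "\<And>z. trajectory G H E d xs z \<Longrightarrow> xs \<in> admissible (fst (z 0)) \<Longrightarrow>
      ((\<lambda>t. infdist (z t) (E_tot G E d xs)) \<longlongrightarrow> 0) at_top"
  shows "Digraph_Component.connected G"
proof (rule ccontr)
  assume "\<not> Digraph_Component.connected G"
  define B where "B = incidence_matrix G"
  obtain f u v where f: "transpose B *v f = 0" "f $ u \<noteq> f $ v"
    using \<open>\<not> Digraph_Component.connected G\<close> connected_iff_incidence_kernel_constant[OF assms(1,2)]
    unfolding B_def by blast
  obtain yb where yb: "yb \<in> edge_space G" "E *v d = B *v yb"
    using match by (auto simp: matching_condition_def B_def)
  obtain p y where p: "p = (axis u 1 - axis v 1) + B *v y" "transpose B *v gradient H p = 0"
    using strictly_convex_bounded_sublevel[OF conv differentiable_imp_continuous_on[OF diff] H_min] diff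
    by (rule stationary_point_along_range)
  have inner_p: "h \<bullet> p = h $ u - h $ v" if "transpose B *v h = 0" for h
  proof -
    have "h \<bullet> (B *v y) = 0"
      unfolding inner_transpose_matrix_vector[symmetric] that by (rule inner_zero_left)
    then show ?thesis by (simp add: p(1) inner_add_right inner_diff_right inner_axis)
  qed
  have "transpose B *v 1 = 0"
    unfolding B_def vec_eq_iff incidence_matrix_transpose_nth[OF assms(1)] by simp
  then have "1 \<bullet> p = 0" using inner_p[of 1] by simp
  have "p \<noteq> 0" using inner_p[OF f(1)] f(2) by auto
  define z where "z = (\<lambda>t::real. (xs + p, yb))"
  have "trajectory G H E d xs z"
  proof -
    have "closed_loop G H E d xs (xs + p, yb) = 0"
      using closed_loop_shifted[OF yb(2)[unfolded B_def], of H xs "(xs + p, yb)"] p(2)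
      unfolding B_def[symmetric] by (simp only: fst_conv snd_conv add_diff_cancel_left') (simp add: zero_prod_def)
    then show ?thesis using yb(1) by (simp add: trajectory_def z_def)
  qed
  moreover have "xs \<in> admissible (fst (z 0))"
    using \<open>1 \<bullet> p = 0\<close> by (simp add: admissible_def z_def inner_vec_def sum.distrib)
  ultimately have "((\<lambda>t::real. infdist (xs + p, yb) (E_tot G E d xs)) \<longlongrightarrow> 0) at_top"
    using lim[of z] by (simp add: z_def)
  then have "infdist (xs + p, yb) (E_tot G E d xs) = 0"
    by (simp add: tendsto_const_iff)
  moreover have "norm p \<le> infdist (xs + p, yb) (E_tot G E d xs)"
  proof -
    have "(xs, yb) \<in> E_tot G E d xs" using yb by (simp add: E_tot_def B_def)
    moreover have "norm p \<le> dist (xs + p, yb) e" if "e \<in> E_tot G E d xs" for e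
    proof -
      have "fst e = xs" using that by (auto simp: E_tot_def)
      then show ?thesis using dist_fst_le[of "(xs + p, yb)" e] by (simp add: dist_norm)
    qed
    ultimately show ?thesis by (auto simp: infdist_def intro!: cINF_greatest)
  qed
  ultimately show False using \<open>p \<noteq> 0\<close> by simp
qed

theorem theorem10:
  fixes G :: "('v::finite, 'e::finite) pre_digraph"
    and H :: "real^'v \<Rightarrow> real"
    and E :: "real^'k^'v" and d :: "real^'k" and xs :: "real^'v"
  assumes "loopfree_digraph G" and "verts G = UNIV"
    and "strictly_convex H" and "twice_differentiable H"
    and "\<And>x. positive_definite (hessian H x)"
    and "\<And>x. H 0 \<le> H x"
    and "signed_unit_columns E"
    and "matching_condition G E d"
  shows "(\<forall>z. trajectory G H E d xs z \<longrightarrow> xs \<in> admissible (fst (z 0)) \<longrightarrow>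
            ((\<lambda>t. infdist (z t) (E_tot G E d xs)) \<longlongrightarrow> 0) at_top)
         \<longleftrightarrow> Digraph_Component.connected G"
proof
  assume "Digraph_Component.connected G"
  then show "\<forall>z. trajectory G H E d xs z \<longrightarrow> xs \<in> admissible (fst (z 0)) \<longrightarrow>
      ((\<lambda>t. infdist (z t) (E_tot G E d xs)) \<longlongrightarrow> 0) at_top"
    using connected_imp_convergence[OF assms(1,2) _ assms(3-6,8)] by blast
next
  assume *: "\<forall>z. trajectory G H E d xs z \<longrightarrow> xs \<in> admissible (fst (z 0)) \<longrightarrow>
      ((\<lambda>t. infdist (z t) (E_tot G E d xs)) \<longlongrightarrow> 0) at_top"
  have "H differentiable_on UNIV" using assms(4) by (simp add: twice_differentiable_def)
  from convergence_imp_connected[OF assms(1-3) this assms(6,8)] *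
  show "Digraph_Component.connected G" by blast
qed

end
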